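(* Let $(c_n)_{n\ge 0}$ be the sequence defined by $c_0=17$ and $c_n-c_{n-1}=13\cdot 2^{2n}$ for all $n\ge 1$. Then $c_n=\frac{1}{3}\left[13\cdot 2^{2n+2}-1\right]$ for all $n\ge 0$; for every odd number in the set $\{c_n : n\ge 0\}$, repeated application of the Collatz function $f$ eventually reaches $1$; and for each $n\ge 0$ the number of Collatz function operations needed to get $1$ from $c_n$ is $N_{c_n}=N_{13}+2n+3$.
   Context: The Collatz function $f:\mathbb{Z}_{\ge 1}\to\mathbb{Z}_{\ge 1}$ is defined by $f(n)=n/2$ if $n$ is even and $f(n)=3n+1$ if $n$ is odd. For a positive integer $k$, $N_k$ denotes the number of Collatz function operations for the number $k$ to get $1$, i.e. the least integer $m\ge 1$ such that the $m$-fold iterate satisfies $f^{m}(k)=1$ (so that $N_1=3$, via $1\to 4\to 2\to 1$), with $N_k=\infty$ if there is no such $m$. *)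

theory Defs
  imports Complex_Main "HOL-Library.Extended_Nat"
begin

text \<open>The Collatz function is only meant on positive integers, which it preserves;
  the value at \<open>0\<close> is irrelevant.\<close>

definition collatz :: "nat \<Rightarrow> nat" where
  "collatz n = (if even n then n div 2 else 3 * n + 1)"

text \<open>At least one application is required, so \<open>collatz_steps 1 = 3\<close>
  (via \<open>1, 4, 2, 1\<close>) and not \<open>0\<close>.\<close>

definition collatz_steps :: "nat \<Rightarrow> enat" where
  "collatz_steps k =
     (if \<exists>m\<ge>1. (collatz ^^ m) k = 1
      then enat (LEAST m. m \<ge> 1 \<and> (collatz ^^ m) k = 1)
      else \<infinity>)"

end

theory Submission
  imports Defs
begin

text \<open>
  The recurrence is made so that \<open>3 * c n + 1 = 13 * 2 ^ (2 * n + 2)\<close>.  This number is even, so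
  \<open>c n\<close> is odd; one tripling step followed by \<open>2 * n + 2\<close> halvings leads from \<open>c n\<close> to \<open>13\<close>.  None
  of the values passed on the way, nor \<open>13\<close> itself, is \<open>1\<close>, so these \<open>2 * n + 3\<close> operations
  simply add to the count for \<open>13\<close> (\<open>collatz_steps_odd\<close>).  The orbit of \<open>13\<close> reaches \<open>1\<close>, hence
  the count for \<open>c n\<close> is finite, which is what reaching \<open>1\<close> means.
\<close>

lemma collatz_steps_eq_infinity_iff:
  "collatz_steps k = \<infinity> \<longleftrightarrow> \<not> (\<exists>m\<ge>1. (collatz ^^ m) k = 1)"
  by (auto simp: collatz_steps_def)

text \<open>
  The hypothesis excludes the case in which the count stops at the first operation: for \<open>k = 2\<close>
  the count is \<open>1\<close>, whereas \<open>1\<close> is counted as needing \<open>3\<close> further operations.  Otherwise the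
  iterates of \<open>k\<close> that equal \<open>1\<close> are those of \<open>collatz k\<close>, with the index shifted by one.
\<close>

lemma collatz_steps_step:
  assumes "collatz k \<noteq> 1"
  shows "collatz_steps k = collatz_steps (collatz k) + 1"
proof -
  let ?P = "\<lambda>m. m \<ge> 1 \<and> (collatz ^^ m) k = 1"
  let ?Q = "\<lambda>m. m \<ge> 1 \<and> (collatz ^^ m) (collatz k) = 1"
  have shift: "?P (Suc m) \<longleftrightarrow> ?Q m" for m
    using assms by (cases m) (auto simp: funpow_Suc_right simp del: funpow.simps(2))
  have ex: "(\<exists>m. ?P m) \<longleftrightarrow> (\<exists>m. ?Q m)"
    by (metis shift not0_implies_Suc not_one_le_zero)
  show ?thesis
  proof (cases "\<exists>m. ?P m")
    case True
    then obtain m where "?P m" by blast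
    then have "(LEAST m. ?P m) = Suc (LEAST m. ?P (Suc m))"
      by (rule Least_Suc) simp
    also have "(LEAST m. ?P (Suc m)) = (LEAST m. ?Q m)"
      by (simp only: shift)
    finally have "(LEAST m. ?P m) = Suc (LEAST m. ?Q m)" .
    with True ex show ?thesis
      by (simp add: collatz_steps_def one_enat_def)
  next
    case False
    with ex have "collatz_steps k = \<infinity>" and "collatz_steps (collatz k) = \<infinity>"
      unfolding collatz_steps_eq_infinity_iff by blast+
    then show ?thesis
      by simp
  qed
qed

text \<open>
  For \<open>m = 1\<close> and \<open>j \<ge> 1\<close> the halvings themselves reach \<open>1\<close> and the count is \<open>j\<close>, not \<open>3 + j\<close>.
\<close>

lemma collatz_steps_mult_power_2:
  assumes "m > 1"
  shows "collatz_steps (m * 2 ^ j) = collatz_steps m + enat j"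
proof (induction j)
  case 0
  then show ?case by (simp flip: zero_enat_def)
next
  case (Suc j)
  have half: "collatz (m * 2 ^ Suc j) = m * 2 ^ j"
    by (simp add: collatz_def)
  with assms have "collatz (m * 2 ^ Suc j) \<noteq> 1"
    by simp
  then have "collatz_steps (m * 2 ^ Suc j) = collatz_steps (m * 2 ^ j) + 1"
    unfolding half[symmetric] by (rule collatz_steps_step)
  also have "\<dots> = collatz_steps m + (enat j + 1)"
    by (simp add: Suc.IH add.assoc)
  finally show ?case
    by (simp add: one_enat_def)
qed

lemma collatz_steps_odd:
  assumes "odd k" and "3 * k + 1 = m * 2 ^ j" and "m > 1"
  shows "collatz_steps k = collatz_steps m + enat (j + 1)"
proof -
  have triple: "collatz k = m * 2 ^ j"
    using assms by (simp add: collatz_def)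
  with assms have "collatz k \<noteq> 1"
    by simp
  then have "collatz_steps k = collatz_steps (m * 2 ^ j) + 1"
    unfolding triple[symmetric] by (rule collatz_steps_step)
  also have "\<dots> = collatz_steps m + (enat j + 1)"
    by (simp add: collatz_steps_mult_power_2[OF \<open>m > 1\<close>] add.assoc)
  finally show ?thesis
    by (simp add: one_enat_def)
qed

lemma collatz_steps_13_finite: "collatz_steps 13 \<noteq> \<infinity>"
proof -
  \<comment> \<open>The orbit is \<open>13, 40, 20, 10, 5, 16, 8, 4, 2, 1\<close>.  The run of halvings after \<open>5\<close> is followed
    only down to \<open>2\<close>, because counts do not add across the value \<open>1\<close>.\<close>
  have "collatz_steps 13 = collatz_steps 5 + enat (3 + 1)"
    by (rule collatz_steps_odd) simp_all
  also have "collatz_steps 5 = collatz_steps 2 + enat (3 + 1)"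
    by (rule collatz_steps_odd) simp_all
  finally have "collatz_steps 13 = \<infinity> \<longleftrightarrow> collatz_steps 2 = \<infinity>"
    by (simp add: plus_eq_infty_iff_enat)
  moreover have "(collatz ^^ 1) 2 = 1"
    by (simp add: collatz_def)
  ultimately show ?thesis
    unfolding collatz_steps_eq_infinity_iff by blast
qed

theorem theorem3:
  fixes c :: "nat \<Rightarrow> nat"
  assumes "c 0 = 17"
    and "\<And>n. n \<ge> 1 \<Longrightarrow> int (c n) - int (c (n - 1)) = 13 * 2 ^ (2 * n)"
  shows "(\<forall>n. real (c n) = 1 / 3 * (13 * 2 ^ (2 * n + 2) - 1))
    \<and> (\<forall>x \<in> range c. odd x \<longrightarrow> (\<exists>m\<ge>1. (collatz ^^ m) x = 1))
    \<and> (\<forall>n. collatz_steps (c n) = collatz_steps 13 + enat (2 * n + 3))"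
proof -
  have closed: "3 * c n + 1 = 13 * 2 ^ (2 * n + 2)" for n
  proof (induction n)
    case 0
    then show ?case by (simp add: assms(1))
  next
    case (Suc n)
    have "int (c (Suc n)) = int (c n + 13 * 2 ^ (2 * Suc n))"
      using assms(2)[of "Suc n"] by simp
    then have "c (Suc n) = c n + 13 * 2 ^ (2 * Suc n)"
      by (simp only: of_nat_eq_iff)
    with Suc.IH show ?case by simp
  qed
  have odd: "odd (c n)" for n
  proof -
    have "even (3 * c n + 1)" unfolding closed by simp
    then show ?thesis by simp
  qed
  have steps: "collatz_steps (c n) = collatz_steps 13 + enat (2 * n + 3)" for n
  proof -
    have "collatz_steps (c n) = collatz_steps 13 + enat (2 * n + 2 + 1)"
      by (rule collatz_steps_odd[OF odd closed]) simp
    also have "2 * n + 2 + 1 = 2 * n + 3"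
      by simp
    finally show ?thesis .
  qed
  have "\<exists>m\<ge>1. (collatz ^^ m) (c n) = 1" for n
  proof -
    have "collatz_steps (c n) \<noteq> \<infinity>"
      using collatz_steps_13_finite by (simp add: steps plus_eq_infty_iff_enat)
    then show ?thesis
      unfolding collatz_steps_eq_infinity_iff by blast
  qed
  moreover have "real (c n) = 1 / 3 * (13 * 2 ^ (2 * n + 2) - 1)" for n
  proof -
    have "real (3 * c n + 1) = real (13 * 2 ^ (2 * n + 2))"
      by (simp only: closed)
    then show ?thesis by simp
  qed
  ultimately show ?thesis
    using steps by blast
qed

end
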